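(* Let $(M,g)$ be an $n$-dimensional $(N(k),\xi)$-semi-Riemannian manifold, let $a_0,\dots,a_7$ be real numbers, and suppose $M$ is $(\mathcal{T}_a,S)$-pseudosymmetric, i.e. $\mathcal{T}_a\cdot S=L\,Q(g,S)$ for a smooth function $L$ on $M$. Then for all vector fields $Y,U$: $$\varepsilon a_5S^2(Y,U)-E\,S(Y,U)-F\,g(Y,U)-G\,\eta(Y)\eta(U)=L\big(\varepsilon k(n-1)g(Y,U)-\varepsilon S(Y,U)\big),$$ where $$E=\varepsilon(ka_0+a_7r-k(n-1)a_1-k(n-1)a_2),$$ $$F=-\varepsilon k(n-1)(ka_0+k(n-1)a_4+a_7r),$$ $$G=-k^2(n-1)^2(a_1+a_2+2a_3+a_4+a_5+2a_6).$$
   Context: $(M,g)$ is an $n$-dimensional semi-Riemannian manifold; $R$ is its curvature tensor (sign convention: constant curvature $c$ means $R(X,Y)Z=c(g(Y,Z)X-g(X,Z)Y)$), $S(Y,Z)=\mathrm{tr}(X\mapsto R(X,Y)Z)$ the Ricci tensor, $Q$ the Ricci operator ($g(QX,Y)=S(X,Y)$), $r$ the scalar curvature, $S^2(X,Y)=S(QX,Y)$. $(N(k),\xi)$-semi-Riemannian manifold: $k$ is a real number and $\xi$ is a vector field with $g(\xi,\xi)=\varepsilon\in\{1,-1\}$ lying in the $k$-nullity distribution, i.e. $R(X,Y)\xi=k(g(Y,\xi)X-g(X,\xi)Y)$ for all $X,Y$; $\eta(X)=\varepsilon g(X,\xi)$. For real $a_0,\dots,a_7$, $\mathcal{T}_a(X,Y)Z=a_0R(X,Y)Z+a_1S(Y,Z)X+a_2S(X,Z)Y+a_3S(X,Y)Z+a_4g(Y,Z)QX+a_5g(X,Z)QY+a_6g(X,Y)QZ+a_7r(g(Y,Z)X-g(X,Z)Y)$.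 For a $(0,2)$ tensor $K$ and endomorphism $F$, $(F\cdot K)(U,V)=-K(FU,V)-K(U,FV)$. $(\mathcal{T}_a\cdot S)(U,V;X,Y)=(\mathcal{T}_a(X,Y)\cdot S)(U,V)$, and $Q(g,S)(U,V;X,Y)=((X\wedge_g Y)\cdot S)(U,V)$ with $(X\wedge_g Y)Z=g(Y,Z)X-g(X,Z)Y$. *)

theory Defs
  imports "HOL-Analysis.Analysis"
begin

section \<open>Smooth maps between open sets of normed spaces\<close>

text \<open>Only used for open \<open>S\<close> in a finite-dimensional space, where it is the usual notion \<open>C\<^sup>k\<close>:
  \<open>f\<close> is differentiable and all its directional derivatives are \<open>C\<^sup>k\<^sup>-\<^sup>1\<close>.\<close>

primrec Ck_on ::
  "nat \<Rightarrow> 'b::real_normed_vector set \<Rightarrow> ('b \<Rightarrow> 'c::real_normed_vector) \<Rightarrow> bool" where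
  "Ck_on 0 S f \<longleftrightarrow> continuous_on S f"
| "Ck_on (Suc k) S f \<longleftrightarrow>
     (\<forall>x\<in>S. f differentiable (at x)) \<and> (\<forall>v. Ck_on k S (\<lambda>x. frechet_derivative f (at x) v))"

definition smooth_on :: "'b::real_normed_vector set \<Rightarrow> ('b \<Rightarrow> 'c::real_normed_vector) \<Rightarrow> bool" where
  "smooth_on S f \<longleftrightarrow> (\<forall>k. Ck_on k S f)"


section \<open>Smooth manifolds\<close>

text \<open>An \<open>n\<close>-dimensional manifold is given by a smooth atlas modelled on \<open>real ^ 'n\<close>,
  \<open>n = CARD('n)\<close>; its underlying space is the union of the chart domains, an open subspace of a
  Hausdorff second countable space. \<open>coords c\<close> is only meaningful on \<open>region c\<close>.\<close>

record ('a, 'n) chart =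
  region :: "'a set"
  coords :: "'a \<Rightarrow> real ^ 'n"

definition chart_inv :: "('a, 'n::finite) chart \<Rightarrow> real ^ 'n \<Rightarrow> 'a" where
  "chart_inv c = inv_into (region c) (coords c)"

definition is_chart :: "('a::topological_space, 'n::finite) chart \<Rightarrow> bool" where
  "is_chart c \<longleftrightarrow> open (region c) \<and> open (coords c ` region c) \<and>
     homeomorphism (region c) (coords c ` region c) (coords c) (chart_inv c)"

definition carrier :: "('a, 'n::finite) chart set \<Rightarrow> 'a set" where
  "carrier A = (\<Union>c\<in>A. region c)"

locale smooth_manifold =
  fixes A :: "('a::{t2_space, second_countable_topology}, 'n::finite) chart set"
  assumes charts: "c \<in> A \<Longrightarrow> is_chart c"
    and smooth_transition: "c \<in> A \<Longrightarrow> d \<in> A \<Longrightarrow>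
      smooth_on (coords c ` (region c \<inter> region d)) (coords d \<circ> chart_inv c)"


section \<open>Tangent vectors, vector fields and functions\<close>

text \<open>Every point \<open>p\<close> gets a preferred chart, and the tangent space at \<open>p\<close> is identified with
  \<open>real ^ 'n\<close> by taking components with respect to that chart. So a vector field is a function
  \<open>'a \<Rightarrow> real ^ 'n\<close> and a tensor at \<open>p\<close> is a multilinear map on \<open>real ^ 'n\<close>, but smoothness has to
  be expressed after passing to the components in one fixed chart.\<close>

definition chart_at :: "('a, 'n::finite) chart set \<Rightarrow> 'a \<Rightarrow> ('a, 'n) chart" where
  "chart_at A p = (SOME c. c \<in> A \<and> p \<in> region c)"

text \<open>Components in the chart \<open>d\<close> of the tangent vector at \<open>p\<close> with components \<open>v\<close> in \<open>c\<close>:\<close>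

definition change_comps ::
  "('a, 'n::finite) chart \<Rightarrow> ('a, 'n) chart \<Rightarrow> 'a \<Rightarrow> real ^ 'n \<Rightarrow> real ^ 'n" where
  "change_comps c d p v = frechet_derivative (coords d \<circ> chart_inv c) (at (coords c p)) v"

text \<open>The component functions of a vector field in the chart \<open>c\<close>, as functions of the coordinates:\<close>

definition field_comps ::
  "('a, 'n::finite) chart set \<Rightarrow> ('a, 'n) chart \<Rightarrow> ('a \<Rightarrow> real ^ 'n) \<Rightarrow> real ^ 'n \<Rightarrow> real ^ 'n" where
  "field_comps A c X x =
     (let p = chart_inv c x in change_comps (chart_at A p) c p (X p))"

definition smooth_fun :: "('a, 'n::finite) chart set \<Rightarrow> 'a set \<Rightarrow> ('a \<Rightarrow> real) \<Rightarrow> bool" where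
  "smooth_fun A U f \<longleftrightarrow>
     (\<forall>c\<in>A. smooth_on (coords c ` (U \<inter> region c)) (f \<circ> chart_inv c))"

definition smooth_field ::
  "('a, 'n::finite) chart set \<Rightarrow> 'a set \<Rightarrow> ('a \<Rightarrow> real ^ 'n) \<Rightarrow> bool" where
  "smooth_field A U X \<longleftrightarrow>
     (\<forall>c\<in>A. smooth_on (coords c ` (U \<inter> region c)) (field_comps A c X))"

definition open_in :: "('a::topological_space, 'n::finite) chart set \<Rightarrow> 'a set \<Rightarrow> bool" where
  "open_in A U \<longleftrightarrow> open U \<and> U \<subseteq> carrier A"

text \<open>The derivative \<open>v(f)\<close> of a function in the direction of a tangent vector at \<open>p\<close>:\<close>

definition dir_deriv ::
  "('a, 'n::finite) chart set \<Rightarrow> 'a \<Rightarrow> real ^ 'n \<Rightarrow> ('a \<Rightarrow> real) \<Rightarrow> real" where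
  "dir_deriv A p v f =
     (let c = chart_at A p in frechet_derivative (f \<circ> chart_inv c) (at (coords c p)) v)"

text \<open>\<open>[X,Y]\<^sup>i = X\<^sup>j \<partial>\<^sub>j Y\<^sup>i - Y\<^sup>j \<partial>\<^sub>j X\<^sup>i\<close>, evaluated in the preferred chart at \<open>p\<close>:\<close>

definition lie_bracket ::
  "('a, 'n::finite) chart set \<Rightarrow> ('a \<Rightarrow> real ^ 'n) \<Rightarrow> ('a \<Rightarrow> real ^ 'n) \<Rightarrow> 'a \<Rightarrow> real ^ 'n" where
  "lie_bracket A X Y p =
     (let c = chart_at A p; x = coords c p in
        frechet_derivative (field_comps A c Y) (at x) (X p)
      - frechet_derivative (field_comps A c X) (at x) (Y p))"


section \<open>Semi-Riemannian metrics and the Levi-Civita connection\<close>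

definition form_index :: "(real ^ 'n \<Rightarrow> real ^ 'n \<Rightarrow> real) \<Rightarrow> nat" where
  "form_index b = Max {dim V | V. subspace V \<and> (\<forall>v\<in>V. v \<noteq> 0 \<longrightarrow> b v v < 0)}"

locale semi_riemannian_manifold = smooth_manifold A
  for A :: "('a::{t2_space, second_countable_topology}, 'n::finite) chart set" +
  fixes g :: "'a \<Rightarrow> real ^ 'n \<Rightarrow> real ^ 'n \<Rightarrow> real"
  assumes metric_bilinear: "p \<in> carrier A \<Longrightarrow> bilinear (g p)"
    and metric_sym: "p \<in> carrier A \<Longrightarrow> g p v w = g p w v"
    and metric_nondegenerate: "p \<in> carrier A \<Longrightarrow> (\<And>w. g p v w = 0) \<Longrightarrow> v = 0"
    and metric_index: "p \<in> carrier A \<Longrightarrow> q \<in> carrier A \<Longrightarrow> form_index (g p) = form_index (g q)"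
    and metric_smooth: "open_in A U \<Longrightarrow> smooth_field A U X \<Longrightarrow> smooth_field A U Y \<Longrightarrow>
      smooth_fun A U (\<lambda>p. g p (X p) (Y p))"

text \<open>Connections act on vector fields defined on arbitrary open subsets \<open>U\<close> of the manifold, with
  \<open>D X Y\<close> standing for the covariant derivative of \<open>Y\<close> along \<open>X\<close>. As HOL functions are total, fields
  on \<open>U\<close> have irrelevant values outside \<open>U\<close>; axiom \<open>local\<close> says that \<open>D\<close> ignores them and commutes
  with restriction to smaller open sets.\<close>

locale affine_connection = smooth_manifold A
  for A :: "('a::{t2_space, second_countable_topology}, 'n::finite) chart set" +
  fixes D :: "('a \<Rightarrow> real ^ 'n) \<Rightarrow> ('a \<Rightarrow> real ^ 'n) \<Rightarrow> 'a \<Rightarrow> real ^ 'n"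
  assumes smooth: "open_in A U \<Longrightarrow> smooth_field A U X \<Longrightarrow> smooth_field A U Y \<Longrightarrow>
      smooth_field A U (D X Y)"
    and local: "open_in A U \<Longrightarrow> smooth_field A U X \<Longrightarrow> smooth_field A U Y \<Longrightarrow>
      smooth_field A U X' \<Longrightarrow> smooth_field A U Y' \<Longrightarrow>
      (\<And>q. q \<in> U \<Longrightarrow> X q = X' q) \<Longrightarrow> (\<And>q. q \<in> U \<Longrightarrow> Y q = Y' q) \<Longrightarrow>
      p \<in> U \<Longrightarrow> D X Y p = D X' Y' p"
    and add_left: "open_in A U \<Longrightarrow> smooth_field A U X \<Longrightarrow> smooth_field A U X' \<Longrightarrow>
      smooth_field A U Y \<Longrightarrow> p \<in> U \<Longrightarrow>
      D (\<lambda>q. X q + X' q) Y p = D X Y p + D X' Y p"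
    and scale_left: "open_in A U \<Longrightarrow> smooth_fun A U f \<Longrightarrow> smooth_field A U X \<Longrightarrow>
      smooth_field A U Y \<Longrightarrow> p \<in> U \<Longrightarrow>
      D (\<lambda>q. f q *\<^sub>R X q) Y p = f p *\<^sub>R D X Y p"
    and add_right: "open_in A U \<Longrightarrow> smooth_field A U X \<Longrightarrow> smooth_field A U Y \<Longrightarrow>
      smooth_field A U Y' \<Longrightarrow> p \<in> U \<Longrightarrow>
      D X (\<lambda>q. Y q + Y' q) p = D X Y p + D X Y' p"
    and leibniz: "open_in A U \<Longrightarrow> smooth_fun A U f \<Longrightarrow> smooth_field A U X \<Longrightarrow>
      smooth_field A U Y \<Longrightarrow> p \<in> U \<Longrightarrow>
      D X (\<lambda>q. f q *\<^sub>R Y q) p = dir_deriv A p (X p) f *\<^sub>R Y p + f p *\<^sub>R D X Y p"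

locale levi_civita_connection = semi_riemannian_manifold A g + affine_connection A D
  for A :: "('a::{t2_space, second_countable_topology}, 'n::finite) chart set" and g D +
  assumes torsion_free: "open_in A U \<Longrightarrow> smooth_field A U X \<Longrightarrow> smooth_field A U Y \<Longrightarrow> p \<in> U \<Longrightarrow>
      D X Y p - D Y X p = lie_bracket A X Y p"
    and metric_compatible: "open_in A U \<Longrightarrow> smooth_field A U X \<Longrightarrow> smooth_field A U Y \<Longrightarrow>
      smooth_field A U Z \<Longrightarrow> p \<in> U \<Longrightarrow>
      dir_deriv A p (X p) (\<lambda>q. g q (Y q) (Z q)) = g p (D X Y p) (Z p) + g p (Y p) (D X Z p)"


section \<open>Curvature\<close>

text \<open>\<open>R p x y z\<close> is \<open>R(x,y)z\<close> for tangent vectors at \<open>p\<close>. Since all tangent vectors at \<open>p\<close> extend to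
  smooth fields near \<open>p\<close>, this condition determines \<open>R p\<close> for every \<open>p\<close> in the manifold.\<close>

definition is_curvature_tensor ::
  "('a::{t2_space, second_countable_topology}, 'n::finite) chart set
    \<Rightarrow> (('a \<Rightarrow> real ^ 'n) \<Rightarrow> ('a \<Rightarrow> real ^ 'n) \<Rightarrow> 'a \<Rightarrow> real ^ 'n)
    \<Rightarrow> ('a \<Rightarrow> real ^ 'n \<Rightarrow> real ^ 'n \<Rightarrow> real ^ 'n \<Rightarrow> real ^ 'n) \<Rightarrow> bool" where
  "is_curvature_tensor A D R \<longleftrightarrow>
     (\<forall>U X Y Z. open_in A U \<and> smooth_field A U X \<and> smooth_field A U Y \<and> smooth_field A U Z \<longrightarrow>
        (\<forall>p\<in>U. R p (X p) (Y p) (Z p) =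
           D X (D Y Z) p - D Y (D X Z) p - D (lie_bracket A X Y) Z p))"

text \<open>The remaining notions are algebra in a single tangent space: \<open>b\<close> is the metric at a point and
  \<open>\<rho>\<close> the curvature tensor at that point.\<close>

type_synonym 'n form = "real ^ 'n \<Rightarrow> real ^ 'n \<Rightarrow> real"
type_synonym 'n curv = "real ^ 'n \<Rightarrow> real ^ 'n \<Rightarrow> real ^ 'n \<Rightarrow> real ^ 'n"

definition ricci :: "'n::finite curv \<Rightarrow> 'n form" where
  "ricci \<rho> y z = trace (matrix (\<lambda>x. \<rho> x y z))"

definition ricci_op :: "'n::finite form \<Rightarrow> 'n curv \<Rightarrow> real ^ 'n \<Rightarrow> real ^ 'n" where
  "ricci_op b \<rho> x = (THE q. \<forall>y. b q y = ricci \<rho> x y)"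

definition scalar_curv :: "'n::finite form \<Rightarrow> 'n curv \<Rightarrow> real" where
  "scalar_curv b \<rho> = trace (matrix (ricci_op b \<rho>))"

definition ricci_sq :: "'n::finite form \<Rightarrow> 'n curv \<Rightarrow> 'n form" where
  "ricci_sq b \<rho> x y = ricci \<rho> (ricci_op b \<rho> x) y"

definition wedge :: "'n::finite form \<Rightarrow> 'n curv" where
  "wedge b x y z = b y z *\<^sub>R x - b x z *\<^sub>R y"

text \<open>The \<open>k\<close>-nullity space at a point:\<close>

definition nullity :: "'n::finite form \<Rightarrow> 'n curv \<Rightarrow> real \<Rightarrow> (real ^ 'n) set" where
  "nullity b \<rho> k = {z. \<forall>x y. \<rho> x y z = k *\<^sub>R (b y z *\<^sub>R x - b x z *\<^sub>R y)}"

text \<open>The tensor \<open>\<T>\<^sub>a\<close>; only \<open>a 0, \<dots>, a 7\<close> occur.\<close>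

definition T_tensor :: "(nat \<Rightarrow> real) \<Rightarrow> 'n::finite form \<Rightarrow> 'n curv \<Rightarrow> 'n curv" where
  "T_tensor a b \<rho> x y z =
     (let S = ricci \<rho>; Q = ricci_op b \<rho>; r = scalar_curv b \<rho> in
        a 0 *\<^sub>R \<rho> x y z
      + (a 1 * S y z) *\<^sub>R x + (a 2 * S x z) *\<^sub>R y + (a 3 * S x y) *\<^sub>R z
      + (a 4 * b y z) *\<^sub>R Q x + (a 5 * b x z) *\<^sub>R Q y + (a 6 * b x y) *\<^sub>R Q z
      + (a 7 * r) *\<^sub>R (b y z *\<^sub>R x - b x z *\<^sub>R y))"

text \<open>The derivation action \<open>F \<cdot> K\<close> of an endomorphism on a \<open>(0,2)\<close> tensor:\<close>

definition act :: "(real ^ 'n::finite \<Rightarrow> real ^ 'n) \<Rightarrow> 'n form \<Rightarrow> 'n form" where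
  "act F K u v = - K (F u) v - K u (F v)"

definition pseudosymmetric ::
  "('a, 'n::finite) chart set \<Rightarrow> ('a \<Rightarrow> 'n form) \<Rightarrow> ('a \<Rightarrow> 'n curv) \<Rightarrow> (nat \<Rightarrow> real) \<Rightarrow> ('a \<Rightarrow> real)
    \<Rightarrow> bool" where
  "pseudosymmetric A g R a L \<longleftrightarrow> smooth_fun A (carrier A) L \<and>
     (\<forall>p\<in>carrier A. \<forall>u v x y.
        act (T_tensor a (g p) (R p) x y) (ricci (R p)) u v =
        L p * act (wedge (g p) x y) (ricci (R p)) u v)"

locale Nk_semi_riemannian_manifold = levi_civita_connection A g D
  for A :: "('a::{t2_space, second_countable_topology}, 'n::finite) chart set" and g D +
  fixes R :: "'a \<Rightarrow> 'n curv" and \<epsilon> k :: real and \<xi> :: "'a \<Rightarrow> real ^ 'n"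
  assumes curvature: "is_curvature_tensor A D R"
    and eps: "\<epsilon> \<in> {1, -1}"
    and xi_smooth: "smooth_field A (carrier A) \<xi>"
    and xi_unit: "p \<in> carrier A \<Longrightarrow> g p (\<xi> p) (\<xi> p) = \<epsilon>"
    and xi_nullity: "p \<in> carrier A \<Longrightarrow> \<xi> p \<in> nullity (g p) (R p) k"

end

theory Submission
  imports Defs
begin

text \<open>
  The asserted identity concerns the tangent space at \<open>p\<close>, and there it is obtained by
  evaluating the pseudosymmetry condition \<open>(T\<^sub>a \<cdot> S)(U, V; X, Y) = L Q(g, S)(U, V; X, Y)\<close> with \<open>\<xi>\<close>
  in the places of \<open>U\<close> and \<open>X\<close>. Every resulting term is known as soon as \<open>S(\<xi>, \<cdot>) = k (n - 1) g(\<xi>, \<cdot>)\<close>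
  and \<open>g(R(\<xi>,y)u, \<xi>) = - g(u, R(\<xi>,y)\<xi>)\<close> are known: this is \<open>pseudosymmetric_at_point\<close>.

  The nullity condition by itself only describes \<open>R(x,y)\<xi>\<close>, whose trace gives \<open>S(\<cdot>, \<xi>)\<close>. To move \<open>\<xi>\<close> to
  another argument one needs the classical symmetries of the curvature tensor: multilinearity, skewness in the
  first two arguments, skewness of each \<open>R(x,y)\<close> with respect to \<open>g\<close>, and the first Bianchi
  identity. The Ricci tensor is then symmetric, because \<open>x \<mapsto> R(x,y)z\<close> and \<open>x \<mapsto> R(x,z)y\<close>
  differ by \<open>R(y,z)\<close>, a \<open>g\<close>-skew endomorphism, which has trace zero (\<open>ricci_sym\<close>).

  These symmetries are derived from the Levi-Civita axioms in \<open>algebraic_curvature_at_point\<close>, by extending tangent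
  vectors at \<open>p\<close> to fields with constant components in the preferred chart at \<open>p\<close>. Such fields
  are smooth (\<open>smooth_coord_field\<close>), depend linearly on the vector, and commute
  (\<open>lie_bracket_coord_field\<close>). This rests on the calculus of \<open>C\<^sup>k\<close> maps: compositions of
  smooth maps are smooth, and second derivatives are symmetric. The latter is used twice: for
  transition maps, where it makes the brackets vanish, and for the function \<open>g(Z,Z)\<close>, where it
  gives the skewness of \<open>R(x,y)\<close>.
\<close>

section \<open>Calculus of smooth maps\<close>

text \<open>For non-open \<open>S\<close> this fails, because derivatives are taken in the whole space.
  On an open set, functions that agree there also have the same derivatives there.\<close>

lemma Ck_on_cong:
  assumes "open S" "\<And>x. x \<in> S \<Longrightarrow> f x = f' x"
  shows "Ck_on k S f \<longleftrightarrow> Ck_on k S f'"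
  using assms(2)
proof (induction k arbitrary: f f')
  case 0
  then show ?case using continuous_on_cong[OF refl, of S f f'] by simp
next
  case (Suc k)
  have iff: "f differentiable (at x) \<longleftrightarrow> f' differentiable (at x)" if "x \<in> S" for x
    unfolding differentiable_def
    using has_derivative_transform_within_open[OF _ assms(1) that, of f _ UNIV f']
      has_derivative_transform_within_open[OF _ assms(1) that, of f' _ UNIV f] Suc.prems by auto
  show ?case
  proof (cases "\<forall>x\<in>S. f differentiable (at x)")
    case True
    have "frechet_derivative f (at x) v = frechet_derivative f' (at x) v" if "x \<in> S" for x v
      using frechet_derivative_transform_within_open[of f x S f'] True assms(1) Suc.prems that by metis
    then have "Ck_on k S (\<lambda>x. frechet_derivative f (at x) v) \<longleftrightarrow>
        Ck_on k S (\<lambda>x. frechet_derivative f' (at x) v)" for v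
      by (intro Suc.IH) auto
    then show ?thesis using iff by auto
  next
    case False
    then show ?thesis using iff by auto
  qed
qed

lemma Ck_on_imp_continuous_on: "Ck_on k S f \<Longrightarrow> continuous_on S f"
  using continuous_at_imp_continuous_on[of S f] differentiable_imp_continuous_within[of f _ UNIV]
  by (cases k) auto

lemma Ck_on_pred: "Ck_on (Suc k) S f \<Longrightarrow> Ck_on k S f"
proof (induction k arbitrary: f)
  case 0
  then show ?case using Ck_on_imp_continuous_on by fastforce
next
  case (Suc k)
  then show ?case by auto
qed

lemma Ck_on_const [simp]: "Ck_on k S (\<lambda>x. c)"
  by (induction k arbitrary: c) auto

lemma Ck_on_add:
  assumes "open S" "Ck_on k S f" "Ck_on k S h"
  shows "Ck_on k S (\<lambda>x. f x + h x)"
  using assms(2,3)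
proof (induction k arbitrary: f h)
  case 0
  then show ?case by (simp add: continuous_on_add)
next
  case (Suc k)
  have "frechet_derivative (\<lambda>x. f x + h x) (at x) v
      = frechet_derivative f (at x) v + frechet_derivative h (at x) v" if "x \<in> S" for x v
  proof -
    have "((\<lambda>x. f x + h x) has_derivative
        (\<lambda>v. frechet_derivative f (at x) v + frechet_derivative h (at x) v)) (at x)"
      using Suc.prems that by (intro has_derivative_add) (auto simp: frechet_derivative_works)
    from frechet_derivative_at[OF this] show ?thesis by metis
  qed
  moreover have "Ck_on k S (\<lambda>x. frechet_derivative f (at x) v + frechet_derivative h (at x) v)" for v
    using Suc by simp
  ultimately have "Ck_on k S (\<lambda>x. frechet_derivative (\<lambda>x. f x + h x) (at x) v)" for v
    by (subst Ck_on_cong[OF assms(1)]) auto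
  then show ?case using Suc.prems by (auto intro: differentiable_add)
qed

lemma Ck_on_sum:
  assumes "open S" "\<And>i. i \<in> I \<Longrightarrow> Ck_on k S (f i)"
  shows "Ck_on k S (\<lambda>x. \<Sum>i\<in>I. f i x)"
  using assms(2)
  by (induction I rule: infinite_finite_induct) (auto intro: Ck_on_add[OF assms(1)])

text \<open>The product rule writes a derivative of \<open>m (f x) (h x)\<close> as a sum of two products whose
  factors are at worst \<open>C\<^sup>k\<close>, so induction on \<open>k\<close> applies. Scalar multiples of vectors and inner
  products are the instances that matter below.\<close>

lemma Ck_on_bilinear:
  assumes "open S" "bounded_bilinear m" "Ck_on k S f" "Ck_on k S h"
  shows "Ck_on k S (\<lambda>x. m (f x) (h x))"
  using assms(3,4)
proof (induction k arbitrary: f h)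
  case 0
  then show ?case using assms(2) by (simp add: bounded_bilinear.continuous_on)
next
  case (Suc k)
  have D: "((\<lambda>x. m (f x) (h x)) has_derivative
      (\<lambda>v. m (f x) (frechet_derivative h (at x) v) + m (frechet_derivative f (at x) v) (h x))) (at x)"
    if "x \<in> S" for x
    using Suc.prems that
    by (intro bounded_bilinear.FDERIV[OF assms(2)]) (auto simp: frechet_derivative_works)
  have "Ck_on k S (\<lambda>x. m (f x) (frechet_derivative h (at x) v) + m (frechet_derivative f (at x) v) (h x))" for v
    using Suc Ck_on_pred[of k S f] Ck_on_pred[of k S h] by (intro Ck_on_add[OF assms(1)] Suc.IH) auto
  moreover have "frechet_derivative (\<lambda>x. m (f x) (h x)) (at x) v
      = m (f x) (frechet_derivative h (at x) v) + m (frechet_derivative f (at x) v) (h x)" if "x \<in> S" for x v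
    using frechet_derivative_at[OF D[OF that]] by metis
  ultimately have "Ck_on k S (\<lambda>x. frechet_derivative (\<lambda>x. m (f x) (h x)) (at x) v)" for v
    by (subst Ck_on_cong[OF assms(1)]) auto
  then show ?case using D by (auto simp: differentiable_def)
qed

lemma frechet_derivative_expand:
  fixes h :: "'a::real_normed_vector \<Rightarrow> 'b::euclidean_space"
  assumes "f differentiable (at y)"
  shows "frechet_derivative f (at y) w = (\<Sum>i\<in>Basis. (w \<bullet> i) *\<^sub>R frechet_derivative f (at y) i)"
proof -
  have l: "linear (frechet_derivative f (at y))"
    using assms by (rule linear_frechet_derivative)
  have "frechet_derivative f (at y) w = frechet_derivative f (at y) (\<Sum>i\<in>Basis. (w \<bullet> i) *\<^sub>R i)"
    by (simp add: euclidean_representation)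
  also have "\<dots> = (\<Sum>i\<in>Basis. (w \<bullet> i) *\<^sub>R frechet_derivative f (at y) i)"
    unfolding linear_sum[OF l] linear_scale[OF l] ..
  finally show ?thesis .
qed

text \<open>The chain rule gives \<open>(f \<circ> h)'(x) v = f'(h x) (h'(x) v)\<close>, in which the direction of \<open>f'\<close> varies
  with \<open>x\<close>, whereas \<^const>\<open>Ck_on\<close> only speaks of fixed directions. Expanding \<open>h'(x) v\<close> in a basis
  turns this into a finite sum of products of a component of \<open>h'(x) v\<close> with a composition
  \<open>\<partial>\<^sub>i f \<circ> h\<close>, to which the induction hypothesis applies.\<close>

lemma Ck_on_compose:
  fixes h :: "'a::real_normed_vector \<Rightarrow> 'b::euclidean_space"
  assumes "open S" "open T" "h ` S \<subseteq> T" "Ck_on k T f" "Ck_on k S h"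
  shows "Ck_on k S (f \<circ> h)"
  using assms(4,5)
proof (induction k arbitrary: f)
  case 0
  then show ?case
    using assms(3) continuous_on_compose[of S h f] continuous_on_subset[of T f "h ` S"] by simp
next
  case (Suc k)
  have df: "f differentiable (at (h x))" and dh: "h differentiable (at x)" if "x \<in> S" for x
    using Suc.prems that assms(3) by auto
  have D: "frechet_derivative (f \<circ> h) (at x) v =
     (\<Sum>i\<in>Basis. (frechet_derivative h (at x) v \<bullet> i) *\<^sub>R frechet_derivative f (at (h x)) i)"
    if "x \<in> S" for x v
    using frechet_derivative_compose[OF dh df, OF that that]
      frechet_derivative_expand[OF df[OF that], of "frechet_derivative h (at x) v"]
    unfolding o_def by (rule trans[OF fun_cong])
  have f': "Ck_on k S (\<lambda>x. frechet_derivative f (at (h x)) i)" for i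
    using Suc.IH[of "\<lambda>y. frechet_derivative f (at y) i"] Suc.prems Ck_on_pred[of k S h]
    by (simp add: o_def)
  have h': "Ck_on k S (\<lambda>x. frechet_derivative h (at x) v \<bullet> i)" for v i
    using Suc.prems by (intro Ck_on_bilinear[OF assms(1) bounded_bilinear_inner]) auto
  have "Ck_on k S (\<lambda>x. frechet_derivative (f \<circ> h) (at x) v)" for v
    by (intro iffD2[OF Ck_on_cong[OF assms(1) D]] Ck_on_sum[OF assms(1)] Ck_on_bilinear[OF assms(1) bounded_bilinear_scaleR] f' h')
  moreover have "(f \<circ> h) differentiable (at x)" if "x \<in> S" for x
    using df[OF that] dh[OF that] by (rule differentiable_chain_at[rotated])
  ultimately show ?case by (simp del: o_apply add: Ck_on.simps(2)[of k S "f \<circ> h"])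
qed

lemma smooth_on_cong:
  assumes "open S" "\<And>x. x \<in> S \<Longrightarrow> f x = f' x"
  shows "smooth_on S f \<longleftrightarrow> smooth_on S f'"
  using Ck_on_cong[OF assms] by (simp add: smooth_on_def)

lemma smooth_on_compose:
  fixes h :: "'a::real_normed_vector \<Rightarrow> 'b::euclidean_space"
  assumes "open S" "open T" "h ` S \<subseteq> T" "smooth_on T f" "smooth_on S h"
  shows "smooth_on S (f \<circ> h)"
  using assms unfolding smooth_on_def by (blast intro: Ck_on_compose)

lemma smooth_on_differentiable:
  assumes "smooth_on S f" "x \<in> S"
  shows "f differentiable (at x)"
proof -
  have "Ck_on (Suc 0) S f" using assms(1) unfolding smooth_on_def ..
  then show ?thesis using assms(2) by simp
qed

lemma smooth_on_deriv:
  assumes "smooth_on S f"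
  shows "smooth_on S (\<lambda>x. frechet_derivative f (at x) v)"
  unfolding smooth_on_def
proof
  fix k
  have "Ck_on (Suc k) S f" using assms unfolding smooth_on_def ..
  then show "Ck_on k S (\<lambda>x. frechet_derivative f (at x) v)" by simp
qed

section \<open>Symmetry of the second derivative\<close>

text \<open>The second difference of \<open>f\<close> over a parallelogram with sides \<open>h v\<close> and \<open>h w\<close> is, by the
  mean value theorem in each of the two directions, \<open>h\<^sup>2\<close> times a mixed second derivative at some
  point of the parallelogram. The second difference does not change when \<open>v\<close> and \<open>w\<close> are exchanged;
  this is where the symmetry of second derivatives comes from.\<close>

lemma second_difference_mvt:
  fixes f :: "'a::real_normed_vector \<Rightarrow> real"
  assumes S: "\<And>s t. 0 \<le> s \<Longrightarrow> s \<le> h \<Longrightarrow> 0 \<le> t \<Longrightarrow> t \<le> h \<Longrightarrow> x + s *\<^sub>R v + t *\<^sub>R w \<in> S"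
    and f: "smooth_on S f" and h: "0 < h"
  shows "\<exists>s t. 0 < s \<and> s < h \<and> 0 < t \<and> t < h \<and>
    f (x + h *\<^sub>R v + h *\<^sub>R w) - f (x + h *\<^sub>R v) - f (x + h *\<^sub>R w) + f x =
    h * h * frechet_derivative (\<lambda>y. frechet_derivative f (at y) v) (at (x + s *\<^sub>R v + t *\<^sub>R w)) w"
proof -
  \<comment> \<open>The chain rule along a curve \<open>c\<close> with velocity \<open>d\<close>.\<close>
  have lin: "(F has_real_derivative frechet_derivative G (at (c s)) d) (at s)"
    if G: "smooth_on S G" and c: "c s \<in> S" "F = (\<lambda>s. G (c s))" "(c has_derivative (\<lambda>r. r *\<^sub>R d)) (at s)"
    for G :: "'a \<Rightarrow> real" and F c d s
  proof -
    have G': "(G has_derivative frechet_derivative G (at (c s))) (at (c s))"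
      using smooth_on_differentiable[OF G c(1)] by (simp add: frechet_derivative_works)
    have "linear (frechet_derivative G (at (c s)))"
      using smooth_on_differentiable[OF G c(1)] by (rule linear_frechet_derivative)
    then have "(\<lambda>r. frechet_derivative G (at (c s)) (r *\<^sub>R d)) = (*) (frechet_derivative G (at (c s)) d)"
      by (auto simp: linear_scale)
    then show ?thesis
      using diff_chain_at[OF c(3) G'] by (simp add: has_field_derivative_def c(2) o_def)
  qed
  define \<phi> where "\<phi> = (\<lambda>s. f (x + s *\<^sub>R v + h *\<^sub>R w) - f (x + s *\<^sub>R v))"
  let ?f' = "\<lambda>y. frechet_derivative f (at y) v"
  have "(\<phi> has_real_derivative ?f' (x + s *\<^sub>R v + h *\<^sub>R w) - ?f' (x + s *\<^sub>R v)) (at s)"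
    if "0 \<le> s" "s \<le> h" for s
    unfolding \<phi>_def using S[of s 0] S[of s h] that h
    by (intro DERIV_diff lin[OF f]) (auto intro!: derivative_eq_intros)
  from MVT2[OF h this] obtain s where s: "0 < s" "s < h"
    "\<phi> h - \<phi> 0 = h * (?f' (x + s *\<^sub>R v + h *\<^sub>R w) - ?f' (x + s *\<^sub>R v))"
    by auto
  define \<psi> where "\<psi> = (\<lambda>t. ?f' (x + s *\<^sub>R v + t *\<^sub>R w))"
  have "(\<psi> has_real_derivative frechet_derivative ?f' (at (x + s *\<^sub>R v + t *\<^sub>R w)) w) (at t)"
    if "0 \<le> t" "t \<le> h" for t
    unfolding \<psi>_def using S[of s t] that s
    by (intro lin[OF smooth_on_deriv[OF f], where c="\<lambda>t. x + s *\<^sub>R v + t *\<^sub>R w"])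
      (auto intro!: derivative_eq_intros)
  from MVT2[OF h this] obtain t where t: "0 < t" "t < h"
    "\<psi> h - \<psi> 0 = h * frechet_derivative ?f' (at (x + s *\<^sub>R v + t *\<^sub>R w)) w"
    by auto
  have "f (x + h *\<^sub>R v + h *\<^sub>R w) - f (x + h *\<^sub>R v) - f (x + h *\<^sub>R w) + f x = \<phi> h - \<phi> 0"
    by (simp add: \<phi>_def)
  also have "\<dots> = h * h * frechet_derivative ?f' (at (x + s *\<^sub>R v + t *\<^sub>R w)) w"
    using s(3) t(3) by (simp add: \<psi>_def)
  finally show ?thesis using s t by blast
qed

text \<open>Computing one and the same second difference in both orders gives equal values of the two mixed
  derivatives at two points of an arbitrarily small parallelogram. By continuity both values are
  within \<open>e\<close> of the respective mixed derivative at \<open>x\<close>.\<close>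

lemma second_derivative_symmetric_real:
  fixes f :: "'a::real_normed_vector \<Rightarrow> real"
  assumes f: "smooth_on S f" and S: "open S" and x: "x \<in> S"
  shows "frechet_derivative (\<lambda>y. frechet_derivative f (at y) v) (at x) w =
         frechet_derivative (\<lambda>y. frechet_derivative f (at y) w) (at x) v"
proof -
  define P where "P = (\<lambda>v w y. frechet_derivative (\<lambda>y. frechet_derivative f (at y) v) (at y) w)"
  have cont: "isCont (P v w) x" for v w
  proof -
    have "smooth_on S (P v w)"
      unfolding P_def by (intro smooth_on_deriv f)
    then show ?thesis
      using S x smooth_on_differentiable differentiable_imp_continuous_within by blast
  qed
  have close: "\<bar>P v w x - P w v x\<bar> \<le> 2 * e" if e: "e > 0" for e
  proof -
    obtain d where d: "d > 0" "\<And>y. dist y x < d \<Longrightarrow> y \<in> S"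
      "\<And>y. dist y x < d \<Longrightarrow> dist (P v w y) (P v w x) < e"
      "\<And>y. dist y x < d \<Longrightarrow> dist (P w v y) (P w v x) < e"
    proof -
      obtain d1 where "d1 > 0" "\<And>y. dist y x < d1 \<Longrightarrow> y \<in> S"
        using S x open_dist by blast
      moreover obtain d2 where "d2 > 0" "\<And>y. dist y x < d2 \<Longrightarrow> dist (P v w y) (P v w x) < e"
        using cont[of v w] e unfolding continuous_at_eps_delta by metis
      moreover obtain d3 where "d3 > 0" "\<And>y. dist y x < d3 \<Longrightarrow> dist (P w v y) (P w v x) < e"
        using cont[of w v] e unfolding continuous_at_eps_delta by metis
      ultimately show ?thesis using that[of "min d1 (min d2 d3)"] by auto
    qed
    \<comment> \<open>A side length for which the whole parallelogram lies within distance \<open>d\<close> of \<open>x\<close>.\<close>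
    define h where "h = d / (norm v + norm w + 1)"
    have n: "norm v + norm w + 1 > 0" by (meson add_nonneg_pos add_nonneg_nonneg norm_ge_zero zero_less_one)
    then have h: "h > 0" using d by (simp add: h_def)
    have near: "dist (x + s *\<^sub>R v' + t *\<^sub>R w') x < d"
      if "0 \<le> s" "s \<le> h" "0 \<le> t" "t \<le> h" "norm v' + norm w' = norm v + norm w" for s t v' w'
    proof -
      have "dist (x + s *\<^sub>R v' + t *\<^sub>R w') x \<le> s * norm v' + t * norm w'"
        using norm_triangle_ineq[of "s *\<^sub>R v'" "t *\<^sub>R w'"] that by (simp add: dist_norm algebra_simps)
      also have "\<dots> \<le> h * norm v' + h * norm w'"
        using that by (intro add_mono mult_right_mono) auto
      also have "\<dots> < h * (norm v + norm w + 1)"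
        using that h by (simp flip: distrib_left)
      also have "\<dots> = d" using n by (simp add: h_def)
      finally show ?thesis .
    qed
    obtain s t where st: "0 < s" "s < h" "0 < t" "t < h"
      "f (x + h *\<^sub>R v + h *\<^sub>R w) - f (x + h *\<^sub>R v) - f (x + h *\<^sub>R w) + f x =
        h * h * P v w (x + s *\<^sub>R v + t *\<^sub>R w)"
      using second_difference_mvt[of h x v w S f] near[of _ _ v w] d(2) f h unfolding P_def by meson
    obtain s' t' where st': "0 < s'" "s' < h" "0 < t'" "t' < h"
      "f (x + h *\<^sub>R w + h *\<^sub>R v) - f (x + h *\<^sub>R w) - f (x + h *\<^sub>R v) + f x =
        h * h * P w v (x + s' *\<^sub>R w + t' *\<^sub>R v)"
      using second_difference_mvt[of h x w v S f] near[of _ _ w v] d(2) f h unfolding P_def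
      by (metis add.commute)
    have "f (x + h *\<^sub>R w + h *\<^sub>R v) = f (x + h *\<^sub>R v + h *\<^sub>R w)"
      by (simp add: add.assoc add.commute[of "h *\<^sub>R w"])
    then have "h * h * P w v (x + s' *\<^sub>R w + t' *\<^sub>R v) = h * h * P v w (x + s *\<^sub>R v + t *\<^sub>R w)"
      using st(5) st'(5) by linarith
    then have eq: "P w v (x + s' *\<^sub>R w + t' *\<^sub>R v) = P v w (x + s *\<^sub>R v + t *\<^sub>R w)"
      using h by simp
    have "dist (P v w (x + s *\<^sub>R v + t *\<^sub>R w)) (P v w x) < e"
      using st near by (intro d(3)) simp
    moreover have "dist (P w v (x + s' *\<^sub>R w + t' *\<^sub>R v)) (P w v x) < e"
      using st' near[of s' t' w v] by (intro d(4)) simp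
    ultimately show ?thesis using eq by (simp add: dist_real_def)
  qed
  have "\<bar>P v w x - P w v x\<bar> \<le> 0"
  proof (rule field_le_epsilon)
    fix e :: real assume "e > 0"
    then show "\<bar>P v w x - P w v x\<bar> \<le> 0 + e" using close[of "e/2"] by simp
  qed
  then show ?thesis by (simp add: P_def)
qed

lemma second_derivative_symmetric:
  fixes f :: "'a::real_normed_vector \<Rightarrow> 'b::euclidean_space"
  assumes f: "smooth_on S f" and S: "open S" and x: "x \<in> S"
  shows "frechet_derivative (\<lambda>y. frechet_derivative f (at y) v) (at x) w =
         frechet_derivative (\<lambda>y. frechet_derivative f (at y) w) (at x) v"
proof (rule euclidean_eqI)
  fix b :: 'b
  assume "b \<in> Basis"
  have D: "frechet_derivative (\<lambda>y. h y \<bullet> b) (at y) v = frechet_derivative h (at y) v \<bullet> b"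
    if "smooth_on S h" "y \<in> S" for h :: "'a \<Rightarrow> 'b" and y v
  proof -
    have "(h has_derivative frechet_derivative h (at y)) (at y)"
      using smooth_on_differentiable[OF that] by (simp add: frechet_derivative_works)
    then show ?thesis
      using frechet_derivative_at[OF has_derivative_inner_left] by metis
  qed
  have f': "smooth_on S (\<lambda>y. frechet_derivative f (at y) v)" for v
    using f by (rule smooth_on_deriv)
  have "smooth_on S (\<lambda>y. f y \<bullet> b)"
    using f S by (auto simp: smooth_on_def intro: Ck_on_bilinear bounded_bilinear_inner)
  note sym = second_derivative_symmetric_real[OF this S x, of v w]
  have D2: "frechet_derivative (\<lambda>y. frechet_derivative (\<lambda>y. f y \<bullet> b) (at y) v) (at x) w
      = frechet_derivative (\<lambda>y. frechet_derivative f (at y) v) (at x) w \<bullet> b" for v w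
  proof -
    have "smooth_on S (\<lambda>y. frechet_derivative f (at y) v \<bullet> b)"
      using f' S by (auto simp: smooth_on_def intro: Ck_on_bilinear bounded_bilinear_inner)
    then have "frechet_derivative (\<lambda>y. frechet_derivative f (at y) v \<bullet> b) (at x)
      = frechet_derivative (\<lambda>y. frechet_derivative (\<lambda>y. f y \<bullet> b) (at y) v) (at x)"
      by (intro frechet_derivative_transform_within_open[OF _ S x] smooth_on_differentiable[OF _ x])
        (auto simp: D[OF f])
    then show ?thesis using D[OF f' x, of v w] by simp
  qed
  show "frechet_derivative (\<lambda>y. frechet_derivative f (at y) v) (at x) w \<bullet> b =
      frechet_derivative (\<lambda>y. frechet_derivative f (at y) w) (at x) v \<bullet> b"
    using sym D2 by simp
qed

section \<open>Linear algebra of a nondegenerate bilinear form\<close>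

lemma linear_functional_eq_inner:
  fixes \<phi> :: "real ^ 'n::finite \<Rightarrow> real"
  assumes "linear \<phi>"
  shows "\<phi> x = x \<bullet> (\<chi> i. \<phi> (axis i 1))"
proof -
  have "\<phi> x = \<phi> (\<Sum>i\<in>UNIV. x $ i *\<^sub>R axis i 1)"
    using basis_expansion[of x] by (simp add: scalar_mult_eq_scaleR)
  also have "\<dots> = x \<bullet> (\<chi> i. \<phi> (axis i 1))"
    by (simp add: linear_sum[OF assms] linear_scale[OF assms] inner_vec_def)
  finally show ?thesis .
qed

locale scalar_product =
  fixes b :: "'n::finite form"
  assumes bil: "bilinear b"
    and sym: "b x y = b y x"
    and nondegenerate: "(\<And>y. b x y = 0) \<Longrightarrow> x = 0"
begin

lemma lin: "linear (b x)" "linear (\<lambda>x. b x y)"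
  using bil by (auto simp: bilinear_def)

lemmas b_simps =
  linear_add[OF lin(1)] linear_diff[OF lin(1)] linear_scale[OF lin(1)] linear_0[OF lin(1)] linear_neg[OF lin(1)]
  linear_add[OF lin(2)] linear_diff[OF lin(2)] linear_scale[OF lin(2)] linear_0[OF lin(2)] linear_neg[OF lin(2)]

definition gram :: "real ^ 'n ^ 'n" where
  "gram = (\<chi> i j. b (axis i 1) (axis j 1))"

lemma b_eq_gram: "b x y = x \<bullet> (gram *v y)"
proof -
  have "b (axis i 1) y = (gram *v y) $ i" for i
    using linear_functional_eq_inner[OF lin(1), of "axis i 1" y]
    by (simp add: gram_def matrix_vector_mult_def inner_vec_def mult.commute)
  then show ?thesis
    using linear_functional_eq_inner[OF lin(2), of x y] by (simp add: inner_vec_def)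
qed

lemma gram_inverse: "\<exists>H. H ** gram = mat 1 \<and> gram ** H = mat 1"
proof -
  have "gram *v x = 0 \<Longrightarrow> x = 0" for x
    using b_eq_gram[of _ x] sym[of x] nondegenerate[of x] by simp
  then have "\<forall>x. gram *v x = 0 \<longrightarrow> x = 0" by blast
  then show ?thesis
    using matrix_left_invertible_ker[of gram] matrix_left_right_inverse by blast
qed

text \<open>Applied to the linear form \<open>S(x, \<cdot>)\<close>, this makes the definite description that defines the
  Ricci operator meaningful.\<close>

lemma ex1_represents:
  assumes "linear \<phi>"
  shows "\<exists>!q. \<forall>y. b q y = \<phi> y"
proof -
  obtain H where H: "gram ** H = mat 1" using gram_inverse by blast
  define w where "w = (\<chi> i. \<phi> (axis i 1))"
  have "b (H *v w) y = \<phi> y" for y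
  proof -
    have "b (H *v w) y = b y (H *v w)" by (rule sym)
    also have "\<dots> = y \<bullet> w" by (simp add: b_eq_gram matrix_vector_mul_assoc H)
    also have "\<dots> = \<phi> y" unfolding w_def by (rule linear_functional_eq_inner[OF assms, symmetric])
    finally show ?thesis .
  qed
  moreover have "q = q'" if "\<forall>y. b q y = \<phi> y" "\<forall>y. b q' y = \<phi> y" for q q'
    using nondegenerate[of "q - q'"] that by (simp add: b_simps)
  ultimately show ?thesis by blast
qed

text \<open>If \<open>B\<close> is the Gram matrix and \<open>M\<close> the matrix of \<open>F\<close>, skewness reads \<open>M\<^sup>T B = - B M\<close>. Hence
  \<open>M = B\<^sup>-\<^sup>1 (B M)\<close> has the trace of \<open>B M B\<^sup>-\<^sup>1 = - M\<^sup>T\<close>, that is, minus its own trace.\<close>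

lemma trace_of_skew_eq_0:
  assumes F: "linear F" and skew: "\<And>x y. b (F x) y = - b x (F y)"
  shows "trace (matrix F) = 0"
proof -
  obtain H where H: "H ** gram = mat 1" "gram ** H = mat 1" using gram_inverse by blast
  define M where "M = matrix F"
  have M: "F x = M *v x" for x using matrix_works[OF F[unfolded linear_matrix_vector_mul_eq[symmetric]]] by (simp add: M_def)
  have "transpose M ** gram = (- 1) *\<^sub>R (gram ** M)"
  proof -
    have "(transpose M ** gram) *v y = ((- 1) *\<^sub>R (gram ** M)) *v y" for y
    proof -
      have "x \<bullet> ((transpose M ** gram) *v y) = x \<bullet> (((- 1) *\<^sub>R (gram ** M)) *v y)" for x
      proof -
        have "x \<bullet> ((transpose M ** gram) *v y) = b (F x) y"
          by (simp add: b_eq_gram M flip: matrix_vector_mul_assoc)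
             (metis dot_lmul_matrix inner_commute)
        also have "\<dots> = x \<bullet> (((- 1) *\<^sub>R (gram ** M)) *v y)"
          unfolding skew[of x y] scaleR_matrix_vector_assoc[symmetric]
          by (simp add: b_eq_gram M matrix_vector_mul_assoc)
        finally show ?thesis .
      qed
      then show ?thesis using vector_eq_ldot by blast
    qed
    then show ?thesis by (simp add: matrix_eq)
  qed
  then have eq: "gram ** M = (- 1) *\<^sub>R (transpose M ** gram)" by simp
  have tr: "trace (c *\<^sub>R N) = c * trace N" for c and N :: "real^'n^'n"
    by (simp add: trace_def sum_distrib_left)
  have scale: "(c *\<^sub>R N) ** N' = c *\<^sub>R (N ** N')" for c and N N' :: "real^'n^'n"
    by (simp add: matrix_matrix_mult_def vec_eq_iff sum_distrib_left mult.assoc)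
  have "trace M = trace (H ** (gram ** M))"
    by (simp add: matrix_mul_assoc H)
  also have "\<dots> = trace ((gram ** M) ** H)" by (rule trace_mul_sym)
  also have "\<dots> = - trace (transpose M ** (gram ** H))"
    unfolding eq scale tr by (simp add: matrix_mul_assoc)
  also have "\<dots> = - trace M" by (simp add: H trace_def transpose_def)
  finally show ?thesis by (simp add: M_def)
qed

end

section \<open>Curvature tensors at a point\<close>

locale algebraic_curvature = scalar_product b for b :: "'n::finite form" +
  fixes \<rho> :: "'n curv"
  assumes lin2: "linear (\<lambda>y. \<rho> x y z)"
    and lin3: "linear (\<lambda>z. \<rho> x y z)"
    and skew12: "\<rho> x y z = - \<rho> y x z"
    and skew34: "b (\<rho> x y z) w = - b z (\<rho> x y w)"
    and bianchi: "\<rho> x y z + \<rho> y z x + \<rho> z x y = 0"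
begin

lemma ricci_eq_sum: "ricci \<rho> y z = (\<Sum>i\<in>UNIV. \<rho> (axis i 1) y z $ i)"
  by (simp add: ricci_def trace_def matrix_def)

lemma linear_ricci: "linear (ricci \<rho> y)" "linear (\<lambda>y. ricci \<rho> y z)"
  by (rule linearI; simp add: ricci_eq_sum linear_add[OF lin2] linear_add[OF lin3]
     linear_scale[OF lin2] linear_scale[OF lin3] sum.distrib sum_distrib_left)+

lemmas ricci_simps =
  linear_add[OF linear_ricci(1)] linear_diff[OF linear_ricci(1)] linear_scale[OF linear_ricci(1)]
  linear_add[OF linear_ricci(2)] linear_diff[OF linear_ricci(2)] linear_scale[OF linear_ricci(2)]

lemma ricci_op: "b (ricci_op b \<rho> x) y = ricci \<rho> x y"
  using theI'[OF ex1_represents[OF linear_ricci(1), of x]] by (simp add: ricci_op_def)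

text \<open>\<open>R(x,y)\<close> is skew with respect to the metric.\<close>

lemma trace_curvature: "(\<Sum>i\<in>UNIV. \<rho> x y (axis i 1) $ i) = 0"
  using trace_of_skew_eq_0[OF lin3 skew34, of x y] by (simp add: trace_def matrix_def)

text \<open>By the Bianchi identity, the endomorphisms \<open>x \<mapsto> R(x,y)z\<close> and \<open>x \<mapsto> R(x,z)y\<close> differ by \<open>R(y,z)\<close>,
  whose trace vanishes.\<close>

lemma ricci_sym: "ricci \<rho> y z = ricci \<rho> z y"
proof -
  have "\<rho> x y z = \<rho> x z y - \<rho> y z x" for x
    using bianchi[of x y z] skew12[of z x y] by (simp add: algebra_simps add_eq_0_iff)
  then show ?thesis
    by (simp add: ricci_eq_sum sum_subtractf trace_curvature)
qed

text \<open>The endomorphism \<open>x \<mapsto> R(x,y)z = k (g(y,z) x - g(x,z) y)\<close> is a multiple of the identity plus an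
  endomorphism of rank at most one, so its trace can be read off.\<close>

lemma ricci_nullity:
  assumes "z \<in> nullity b \<rho> k"
  shows "ricci \<rho> y z = k * (real CARD('n) - 1) * b y z"
proof -
  have b_yz: "b y z = (\<Sum>i\<in>UNIV. b (axis i 1) z * y $ i)"
    using linear_functional_eq_inner[OF lin(2), of y z] by (simp add: inner_vec_def mult.commute)
  have "\<rho> (axis i 1) y z $ i = k * (b y z - b (axis i 1) z * y $ i)" for i
    using assms by (simp add: nullity_def)
  then have "ricci \<rho> y z = (\<Sum>i\<in>UNIV. k * b y z - k * (b (axis i 1) z * y $ i))"
    by (simp add: ricci_eq_sum right_diff_distrib)
  also have "\<dots> = real CARD('n) * (k * b y z) - k * b y z"
    by (simp add: sum_subtractf b_yz flip: sum_distrib_left)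
  finally show ?thesis by (simp add: algebra_simps)
qed

text \<open>The pseudosymmetry condition is evaluated on the arguments \<open>(\<xi>, u; \<xi>, y)\<close>. Placing \<open>\<xi>\<close> twice
  makes every term computable: \<open>S(\<xi>, \<cdot>) = \<kappa> g(\<xi>, \<cdot>)\<close> and \<open>Q \<xi> = \<kappa> \<xi>\<close> with \<open>\<kappa> = k (n - 1)\<close>, while
  \<open>R(\<xi>,y)\<xi>\<close> and, by skewness, \<open>g(R(\<xi>,y)u, \<xi>)\<close> come from the nullity condition. The only term
  with \<open>S\<^sup>2\<close> is \<open>a\<^sub>5 g(\<xi>,\<xi>) S(Q y, u)\<close>. Both sides of the conclusion are the negatives of those
  of the condition.\<close>

lemma pseudosymmetric_at_point:
  assumes null: "\<xi> \<in> nullity b \<rho> k" and unit: "b \<xi> \<xi> = \<epsilon>"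
    and psym: "act (T_tensor a b \<rho> \<xi> y) (ricci \<rho>) \<xi> u = L * act (wedge b \<xi> y) (ricci \<rho>) \<xi> u"
  defines "n \<equiv> real CARD('n)" and "S \<equiv> ricci \<rho>" and "r \<equiv> scalar_curv b \<rho>"
  shows "\<epsilon> * a 5 * ricci_sq b \<rho> y u
      - \<epsilon> * (k * a 0 + a 7 * r - k * (n - 1) * a 1 - k * (n - 1) * a 2) * S y u
      + \<epsilon> * k * (n - 1) * (k * a 0 + k * (n - 1) * a 4 + a 7 * r) * b y u
      + k\<^sup>2 * (n - 1)\<^sup>2 * (a 1 + a 2 + 2 * a 3 + a 4 + a 5 + 2 * a 6) * b y \<xi> * b u \<xi>
    = L * (\<epsilon> * k * (n - 1) * b y u - \<epsilon> * S y u)"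
proof -
  define \<kappa> where "\<kappa> = k * (n - 1)"
  let ?Q = "ricci_op b \<rho>"
  have S_xi: "S x \<xi> = \<kappa> * b x \<xi>" "S \<xi> x = \<kappa> * b x \<xi>" for x
    using ricci_nullity[OF null, of x] ricci_sym[of \<xi> x] by (auto simp: S_def \<kappa>_def n_def)
  have Q: "b (?Q x) z = S x z" for x z by (simp add: ricci_op S_def)
  have Q_xi: "?Q \<xi> = \<kappa> *\<^sub>R \<xi>"
    using nondegenerate[of "?Q \<xi> - \<kappa> *\<^sub>R \<xi>"] by (simp add: b_simps Q S_xi sym[of \<xi>])
  have R_xi: "\<rho> \<xi> y \<xi> = k *\<^sub>R (b y \<xi> *\<^sub>R \<xi> - \<epsilon> *\<^sub>R y)"
    using null unit by (simp add: nullity_def)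
  have R_xi': "b (\<rho> \<xi> y u) \<xi> = k * (\<epsilon> * b y u - b y \<xi> * b u \<xi>)"
    unfolding skew34 R_xi by (simp add: b_simps sym[of u y] algebra_simps)
  have S_simps: "S x (v + w) = S x v + S x w" "S x (v - w) = S x v - S x w" "S x (c *\<^sub>R v) = c * S x v"
    "S (v + w) x = S v x + S w x" "S (v - w) x = S v x - S w x" "S (c *\<^sub>R v) x = c * S v x" for x v w c
    by (simp_all add: S_def ricci_simps)
  have T1: "S (T_tensor a b \<rho> \<xi> y \<xi>) u =
      \<kappa> * b y \<xi> * b u \<xi> * (a 0 * k + \<kappa> * (a 1 + a 3 + a 4 + a 6) + a 7 * r)
      + \<epsilon> * (a 2 * \<kappa> - a 0 * k - a 7 * r) * S y u + a 5 * \<epsilon> * ricci_sq b \<rho> y u"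
    unfolding T_tensor_def Let_def ricci_sq_def R_xi Q_xi S_def[symmetric] r_def[symmetric]
    by (simp add: S_simps S_xi unit sym[of \<xi> y] algebra_simps)
  have T2: "S \<xi> (T_tensor a b \<rho> \<xi> y u) =
      \<kappa> * (a 0 * k * (\<epsilon> * b y u - b y \<xi> * b u \<xi>) + a 1 * \<epsilon> * S y u
        + \<kappa> * b y \<xi> * b u \<xi> * (a 2 + a 3 + a 5 + a 6) + a 4 * \<kappa> * \<epsilon> * b y u
        + a 7 * r * (\<epsilon> * b y u - b y \<xi> * b u \<xi>))"
    unfolding T_tensor_def Let_def Q_xi S_def[symmetric] r_def[symmetric]
    by (simp add: S_xi b_simps R_xi' Q unit sym[of \<xi> y] sym[of \<xi> u] algebra_simps)
  have W: "act (wedge b \<xi> y) S \<xi> u = - (\<epsilon> * \<kappa> * b y u - \<epsilon> * S y u)"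
    by (simp add: act_def wedge_def S_simps S_xi b_simps unit sym[of \<xi> y] sym[of \<xi> u] algebra_simps)
  have "S (T_tensor a b \<rho> \<xi> y \<xi>) u + S \<xi> (T_tensor a b \<rho> \<xi> y u) = L * (\<epsilon> * \<kappa> * b y u - \<epsilon> * S y u)"
    using psym[folded S_def] unfolding W by (simp add: act_def algebra_simps)
  then show ?thesis
    unfolding T1 T2 by (simp add: \<kappa>_def algebra_simps power2_eq_square)
qed

end

section \<open>Coordinate vector fields\<close>

text \<open>The field with constant components \<open>v\<close> in the chart \<open>c\<close>, expressed at each point \<open>q\<close> in the
  components of the preferred chart at \<open>q\<close>; for \<open>v\<close> a basis vector this is a coordinate field
  \<open>\<partial>\<^sub>i\<close>. Only its values on the region of \<open>c\<close> are meaningful.\<close>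

definition coord_field ::
  "('a, 'n::finite) chart set \<Rightarrow> ('a, 'n) chart \<Rightarrow> real ^ 'n \<Rightarrow> 'a \<Rightarrow> real ^ 'n" where
  "coord_field A c v q = change_comps c (chart_at A q) q v"

context smooth_manifold
begin

lemma chart_at: "p \<in> carrier A \<Longrightarrow> chart_at A p \<in> A" "p \<in> carrier A \<Longrightarrow> p \<in> region (chart_at A p)"
  using someI_ex[of "\<lambda>c. c \<in> A \<and> p \<in> region c"] by (auto simp: carrier_def chart_at_def)

lemma open_in_region: "c \<in> A \<Longrightarrow> open_in A (region c)"
  using charts by (auto simp: open_in_def is_chart_def carrier_def)

lemma chart_inv_coords [simp]: "c \<in> A \<Longrightarrow> q \<in> region c \<Longrightarrow> chart_inv c (coords c q) = q"
  using charts[of c] by (auto simp: is_chart_def homeomorphism_def)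

lemma open_coords_image:
  assumes "c \<in> A" "open V"
  shows "open (coords c ` (V \<inter> region c))"
proof -
  have c: "open (coords c ` region c)"
    "homeomorphism (region c) (coords c ` region c) (coords c) (chart_inv c)"
    using charts[OF assms(1)] by (auto simp: is_chart_def)
  have "openin (top_of_set (region c)) (V \<inter> region c)"
    using assms(2) openin_open by blast
  from homeomorphism_imp_open_map[OF c(2) this] show ?thesis
    using c(1) openin_open_eq by blast
qed

lemma smooth_transition':
  "c \<in> A \<Longrightarrow> d \<in> A \<Longrightarrow> smooth_on (coords c ` (region d \<inter> region c)) (coords d \<circ> chart_inv c)"
  using smooth_transition[of c d] by (simp add: Int_commute)

lemma transition_differentiable:
  assumes "c \<in> A" "d \<in> A" "q \<in> region c" "q \<in> region d"
  shows "(coords d \<circ> chart_inv c) differentiable (at (coords c q))"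
  using assms by (intro smooth_on_differentiable[OF smooth_transition]) auto

lemma change_comps_linear:
  assumes "c \<in> A" "d \<in> A" "q \<in> region c" "q \<in> region d"
  shows "linear (change_comps c d q)"
  using linear_frechet_derivative[OF transition_differentiable[OF assms]]
  by (simp add: change_comps_def[abs_def])

text \<open>The chain rule for transition maps: changing components from \<open>c\<close> to \<open>d\<close> and then to \<open>e\<close> is the
  same as changing from \<open>c\<close> to \<open>e\<close>. It frees the computations below from the
  choice of preferred charts, which may jump from point to point.\<close>

lemma change_comps_chain:
  assumes "c \<in> A" "d \<in> A" "e \<in> A" "q \<in> region c" "q \<in> region d" "q \<in> region e"
  shows "change_comps d e q (change_comps c d q v) = change_comps c e q v"
proof -
  let ?cd = "coords d \<circ> chart_inv c" and ?de = "coords e \<circ> chart_inv d"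
  let ?S = "coords c ` ((region d \<inter> region e) \<inter> region c)"
  have q: "?cd (coords c q) = coords d q" using assms by simp
  have d: "?cd differentiable (at (coords c q))" "?de differentiable (at (?cd (coords c q)))"
    unfolding q using assms by (auto intro!: transition_differentiable)
  have "open ?S" using assms charts by (intro open_coords_image open_Int) (auto simp: is_chart_def)
  then have "frechet_derivative (?de \<circ> ?cd) (at (coords c q))
      = frechet_derivative (coords e \<circ> chart_inv c) (at (coords c q))"
    using assms by (intro frechet_derivative_transform_within_open[OF differentiable_chain_at[OF d]]) auto
  then show ?thesis
    unfolding change_comps_def frechet_derivative_compose[OF d] unfolding q
    by (metis comp_apply)
qed

lemma change_comps_self:
  assumes "c \<in> A" "q \<in> region c"
  shows "change_comps c c q v = v"
proof -
  have "open (coords c ` region c)" using charts[OF assms(1)] by (simp add: is_chart_def)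
  then have "frechet_derivative (\<lambda>x. x) (at (coords c q))
      = frechet_derivative (coords c \<circ> chart_inv c) (at (coords c q))"
    using assms by (intro frechet_derivative_transform_within_open) auto
  then show ?thesis by (simp add: change_comps_def del: o_apply) (metis frechet_derivative_ident)
qed

lemma coord_field_at:
  assumes "p \<in> carrier A"
  shows "coord_field A (chart_at A p) v p = v"
  using chart_at[OF assms] by (simp add: coord_field_def change_comps_self)

lemma region_carrier: "c \<in> A \<Longrightarrow> q \<in> region c \<Longrightarrow> q \<in> carrier A"
  by (auto simp: carrier_def)

lemma coord_field_linear:
  assumes "c \<in> A" "q \<in> region c"
  shows "linear (\<lambda>v. coord_field A c v q)"
  using change_comps_linear[OF assms(1) chart_at(1) assms(2) chart_at(2)] region_carrier[OF assms]
  by (simp add: coord_field_def)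

text \<open>The components in another chart \<open>d\<close> are a directional derivative of the transition map \<open>c \<rightarrow> d\<close>,
  precomposed with the inverse transition map.\<close>

lemma field_comps_coord_field:
  assumes "c \<in> A" "d \<in> A" "y \<in> coords d ` (region c \<inter> region d)"
  shows "field_comps A d (coord_field A c v) y =
    ((\<lambda>x. frechet_derivative (coords d \<circ> chart_inv c) (at x) v) \<circ> (coords c \<circ> chart_inv d)) y"
proof -
  obtain q where q: "q \<in> region c" "q \<in> region d" "y = coords d q" using assms(3) by blast
  have "field_comps A d (coord_field A c v) y = change_comps c d q v"
    using change_comps_chain[OF assms(1) chart_at(1) assms(2) q(1) chart_at(2) q(2)]
      region_carrier[OF assms(1) q(1)] q assms
    by (simp add: field_comps_def coord_field_def)
  then show ?thesis using q assms by (simp add: change_comps_def)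
qed

lemma transition_overlap:
  assumes "c \<in> A" "d \<in> A"
  shows "(coords c \<circ> chart_inv d) ` coords d ` (region c \<inter> region d) \<subseteq> coords c ` (region d \<inter> region c)"
  using assms by auto

lemma open_overlap: "c \<in> A \<Longrightarrow> d \<in> A \<Longrightarrow> open (coords d ` (region c \<inter> region d))"
  using charts by (intro open_coords_image) (auto simp: is_chart_def)

lemma smooth_coord_field:
  assumes "c \<in> A"
  shows "smooth_field A (region c) (coord_field A c v)"
  unfolding smooth_field_def
proof
  fix d assume d: "d \<in> A"
  let ?S = "coords d ` (region c \<inter> region d)"
  let ?h = "(\<lambda>x. frechet_derivative (coords d \<circ> chart_inv c) (at x) v) \<circ> (coords c \<circ> chart_inv d)"
  have "smooth_on ?S ?h"
    using smooth_on_deriv[OF smooth_transition'[OF assms d]] smooth_transition'[OF d assms]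
    by (rule smooth_on_compose[OF open_overlap[OF assms d] open_overlap[OF d assms]
          transition_overlap[OF assms d]])
  moreover have "field_comps A d (coord_field A c v) y = ?h y" if "y \<in> ?S" for y
    using field_comps_coord_field[OF assms d that] .
  ultimately show "smooth_on ?S (field_comps A d (coord_field A c v))"
    using smooth_on_cong[OF open_overlap[OF assms d], of "field_comps A d (coord_field A c v)" ?h] by blast
qed

text \<open>The derivative of a function on the manifold in the direction of a tangent vector does not
  depend on the chart in which it is computed. Here \<open>h\<close> and \<open>h'\<close> are the expressions of that
  function in the charts \<open>c\<close> and \<open>d\<close>.\<close>

lemma frechet_derivative_transition:
  fixes h :: "real ^ 'n \<Rightarrow> 'b::real_normed_vector"
  assumes c: "c \<in> A" and d: "d \<in> A" and q: "q \<in> region c" "q \<in> region d"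
    and h: "h differentiable (at (coords c q))"
    and V: "open V" "coords d q \<in> V" and eq: "\<And>y. y \<in> V \<Longrightarrow> h' y = (h \<circ> (coords c \<circ> chart_inv d)) y"
  shows "frechet_derivative h' (at (coords d q)) (change_comps c d q v)
       = frechet_derivative h (at (coords c q)) v"
proof -
  let ?dc = "coords c \<circ> chart_inv d"
  have dc: "?dc differentiable (at (coords d q))" using transition_differentiable[OF d c q(2,1)] .
  have h2: "h differentiable (at (?dc (coords d q)))" using h d q by simp
  have "frechet_derivative (h \<circ> ?dc) (at (coords d q)) = frechet_derivative h' (at (coords d q))"
    using eq by (intro frechet_derivative_transform_within_open[OF differentiable_chain_at[OF dc h2] V]) simp
  then have "frechet_derivative h' (at (coords d q)) (change_comps c d q v)
      = frechet_derivative h (at (coords c q)) (change_comps d c q (change_comps c d q v))"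
    using frechet_derivative_compose[OF dc h2] d q
    by (simp add: change_comps_def[of d c] del: o_apply) (metis chart_inv_coords comp_apply)
  then show ?thesis
    using change_comps_chain[OF c d c q q(1)] change_comps_self[OF c q(1)] by simp
qed

text \<open>In the preferred chart \<open>d\<close> at \<open>q\<close> both terms of the bracket are second
  derivatives of the transition map \<open>c \<rightarrow> d\<close>, in the directions \<open>v, w\<close> and \<open>w, v\<close>.\<close>

lemma lie_bracket_coord_field:
  assumes c: "c \<in> A" and q: "q \<in> region c"
  shows "lie_bracket A (coord_field A c v) (coord_field A c w) q = 0"
proof -
  define d where "d = chart_at A q"
  have d: "d \<in> A" "q \<in> region d" using chart_at region_carrier[OF c q] by (auto simp: d_def)
  let ?P = "\<lambda>v w. frechet_derivative (\<lambda>x. frechet_derivative (coords d \<circ> chart_inv c) (at x) v) (at (coords c q)) w"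
  have x: "coords c q \<in> coords c ` (region d \<inter> region c)" using q d by blast
  have "frechet_derivative (field_comps A d (coord_field A c v)) (at (coords d q)) (coord_field A c w q)
      = ?P v w" for v w
    unfolding coord_field_def[of A c w] d_def[symmetric]
    using q d field_comps_coord_field[OF c d(1)]
    by (intro frechet_derivative_transition[OF c d(1) q d(2) _ open_overlap[OF c d(1)]]
          smooth_on_differentiable[OF smooth_on_deriv[OF smooth_transition'[OF c d(1)]] x]) auto
  moreover have "?P v w = ?P w v"
    by (rule second_derivative_symmetric[OF smooth_transition'[OF c d(1)] open_overlap[OF d(1) c] x])
  ultimately show ?thesis by (simp add: lie_bracket_def Let_def flip: d_def)
qed

lemma smooth_fun_comp_chart_inv:
  assumes "c \<in> A" "smooth_fun A (region c) f"
  shows "smooth_on (coords c ` region c) (f \<circ> chart_inv c)"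
  using assms by (auto simp: smooth_fun_def)

lemma open_coords_region: "c \<in> A \<Longrightarrow> open (coords c ` region c)"
  using charts by (simp add: is_chart_def)

lemma dir_deriv_coord_field:
  assumes c: "c \<in> A" and q: "q \<in> region c" and f: "smooth_fun A (region c) f"
  shows "dir_deriv A q (coord_field A c v q) f = frechet_derivative (f \<circ> chart_inv c) (at (coords c q)) v"
proof -
  define d where "d = chart_at A q"
  have d: "d \<in> A" "q \<in> region d" using chart_at region_carrier[OF c q] by (auto simp: d_def)
  show ?thesis
    unfolding dir_deriv_def Let_def coord_field_def d_def[symmetric]
    using c q d smooth_on_differentiable[OF smooth_fun_comp_chart_inv[OF c f]]
    by (intro frechet_derivative_transition[OF c d(1) q d(2) _ open_overlap[OF c d(1)]]) auto
qed

lemma dir_deriv_cong: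
  assumes p: "p \<in> carrier A" and V: "open_in A V" "p \<in> V" and f: "smooth_fun A V f"
    and eq: "\<And>q. q \<in> V \<Longrightarrow> f q = f' q"
  shows "dir_deriv A p v f = dir_deriv A p v f'"
proof -
  define c where "c = chart_at A p"
  have c: "c \<in> A" "p \<in> region c" using chart_at[OF p] by (auto simp: c_def)
  have S: "open (coords c ` (V \<inter> region c))" "coords c p \<in> coords c ` (V \<inter> region c)"
    using open_coords_image[OF c(1)] V c by (auto simp: open_in_def)
  have "f \<circ> chart_inv c differentiable (at (coords c p))"
    using f c S(2) by (auto simp: smooth_fun_def intro: smooth_on_differentiable)
  then have "frechet_derivative (f \<circ> chart_inv c) (at (coords c p))
      = frechet_derivative (f' \<circ> chart_inv c) (at (coords c p))"
    using eq c by (intro frechet_derivative_transform_within_open[OF _ S]) auto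
  then show ?thesis by (simp add: dir_deriv_def Let_def flip: c_def)
qed

text \<open>In the chart \<open>c\<close> both sides are second partial derivatives of the function \<open>f \<circ> c\<^sup>-\<^sup>1\<close>.\<close>

lemma dir_deriv_commute:
  assumes p: "p \<in> carrier A" and c: "c = chart_at A p" and f: "smooth_fun A (region c) f"
  shows "dir_deriv A p v (\<lambda>q. dir_deriv A q (coord_field A c w q) f)
       = dir_deriv A p w (\<lambda>q. dir_deriv A q (coord_field A c v q) f)"
proof -
  have cA: "c \<in> A" "p \<in> region c" using chart_at[OF p] by (auto simp: c)
  have x: "coords c p \<in> coords c ` region c" using cA by blast
  note S = open_coords_region[OF cA(1)] and F = smooth_fun_comp_chart_inv[OF cA(1) f]
  let ?F = "\<lambda>w x. frechet_derivative (f \<circ> chart_inv c) (at x) w"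
  have "dir_deriv A p v (\<lambda>q. dir_deriv A q (coord_field A c w q) f)
      = frechet_derivative (?F w) (at (coords c p)) v" for v w
  proof -
    have "frechet_derivative (?F w) (at (coords c p)) =
        frechet_derivative ((\<lambda>q. dir_deriv A q (coord_field A c w q) f) \<circ> chart_inv c) (at (coords c p))"
      using cA dir_deriv_coord_field[OF cA(1) _ f]
      by (intro frechet_derivative_transform_within_open[OF _ S x]
          smooth_on_differentiable[OF smooth_on_deriv[OF F] x]) auto
    then show ?thesis by (simp add: dir_deriv_def Let_def flip: c)
  qed
  then show ?thesis using second_derivative_symmetric[OF F S x] by simp
qed

lemma smooth_field_cong:
  assumes "open_in A V" "\<And>q. q \<in> V \<Longrightarrow> X q = X' q" "smooth_field A V X"
  shows "smooth_field A V X'"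
  unfolding smooth_field_def
proof
  fix c assume c: "c \<in> A"
  have "open (coords c ` (V \<inter> region c))" using assms c by (intro open_coords_image) (auto simp: open_in_def)
  moreover have "field_comps A c X x = field_comps A c X' x" if "x \<in> coords c ` (V \<inter> region c)" for x
    using that c assms(2) by (auto simp: field_comps_def)
  ultimately show "smooth_on (coords c ` (V \<inter> region c)) (field_comps A c X')"
    using assms(3) c smooth_on_cong by (metis smooth_field_def)
qed

lemma smooth_fun_const: "smooth_fun A V (\<lambda>_. r)"
  by (simp add: smooth_fun_def smooth_on_def o_def)

lemma dir_deriv_const: "dir_deriv A p v (\<lambda>_. r) = 0"
  by (simp add: dir_deriv_def Let_def o_def)

end

section \<open>Symmetries of the curvature of the Levi-Civita connection\<close>

context affine_connection
begin

context
  fixes V assumes V: "open_in A V"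
begin

text \<open>A field with constant components is additive and homogeneous in these components only on the
  region of its chart. Hence the four rules below ask \<open>W\<close> to be the given combination of fields only on
  \<open>V\<close>, and axiom \<open>local\<close> absorbs the difference elsewhere.\<close>

lemma D_add_right:
  assumes "smooth_field A V X" "smooth_field A V Y" "smooth_field A V Y'" "smooth_field A V W"
    and W: "\<And>q. q \<in> V \<Longrightarrow> W q = Y q + Y' q" and p: "p \<in> V"
  shows "D X W p = D X Y p + D X Y' p"
proof -
  have "smooth_field A V (\<lambda>q. Y q + Y' q)" using W by (rule smooth_field_cong[OF V _ assms(4)])
  then have "D X W p = D X (\<lambda>q. Y q + Y' q) p" using assms by (intro local[OF V]) auto
  then show ?thesis using add_right[OF V assms(1-3) p] by simp
qed

lemma D_scale_right:
  assumes "smooth_field A V X" "smooth_field A V Y" "smooth_field A V W"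
    and W: "\<And>q. q \<in> V \<Longrightarrow> W q = r *\<^sub>R Y q" and p: "p \<in> V"
  shows "D X W p = r *\<^sub>R D X Y p"
proof -
  have "smooth_field A V (\<lambda>q. r *\<^sub>R Y q)" using W by (rule smooth_field_cong[OF V _ assms(3)])
  then have "D X W p = D X (\<lambda>q. r *\<^sub>R Y q) p" using assms by (intro local[OF V]) auto
  then show ?thesis using leibniz[OF V smooth_fun_const assms(1,2) p] by (simp add: dir_deriv_const)
qed

lemma D_add_left:
  assumes "smooth_field A V Y" "smooth_field A V X" "smooth_field A V X'" "smooth_field A V W"
    and W: "\<And>q. q \<in> V \<Longrightarrow> W q = X q + X' q" and p: "p \<in> V"
  shows "D W Y p = D X Y p + D X' Y p"
proof -
  have "smooth_field A V (\<lambda>q. X q + X' q)" using W by (rule smooth_field_cong[OF V _ assms(4)])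
  then have "D W Y p = D (\<lambda>q. X q + X' q) Y p" using assms by (intro local[OF V]) auto
  then show ?thesis using add_left[OF V assms(2,3,1) p] by simp
qed

lemma D_scale_left:
  assumes "smooth_field A V Y" "smooth_field A V X" "smooth_field A V W"
    and W: "\<And>q. q \<in> V \<Longrightarrow> W q = r *\<^sub>R X q" and p: "p \<in> V"
  shows "D W Y p = r *\<^sub>R D X Y p"
proof -
  have "smooth_field A V (\<lambda>q. r *\<^sub>R X q)" using W by (rule smooth_field_cong[OF V _ assms(3)])
  then have "D W Y p = D (\<lambda>q. r *\<^sub>R X q) Y p" using assms by (intro local[OF V]) auto
  then show ?thesis using scale_left[OF V smooth_fun_const assms(2,1) p] by simp
qed

end

text \<open>Coordinate fields commute, so the term \<open>D\<^sub>[\<^sub>X\<^sub>,\<^sub>Y\<^sub>] Z\<close> of the curvature disappears.\<close>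

lemma curvature_coord_field:
  assumes R: "is_curvature_tensor A D R" and p: "p \<in> carrier A"
  defines "e \<equiv> coord_field A (chart_at A p)"
  shows "R p x y z = D (e x) (D (e y) (e z)) p - D (e y) (D (e x) (e z)) p"
proof -
  define c where "c = chart_at A p"
  have c: "c \<in> A" "p \<in> region c" using chart_at[OF p] by (auto simp: c_def)
  note V = open_in_region[OF c(1)]
  have e: "smooth_field A (region c) (e v)" for v
    unfolding e_def c_def[symmetric] by (rule smooth_coord_field[OF c(1)])
  have br: "lie_bracket A (e x) (e y) q = 0" if "q \<in> region c" for q
    unfolding e_def c_def[symmetric] by (rule lie_bracket_coord_field[OF c(1) that])
  have e0: "e 0 q = 0" if "q \<in> region c" for q
    unfolding e_def c_def[symmetric] using coord_field_linear[OF c(1) that] by (rule linear_0)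
  have "smooth_field A (region c) (lie_bracket A (e x) (e y))"
    using e0 br by (intro smooth_field_cong[OF V _ e[of 0]]) simp
  then have "D (lie_bracket A (e x) (e y)) (e z) p = 0 *\<^sub>R D (e x) (e z) p"
    using br c e by (intro D_scale_left[OF V]) auto
  moreover have "R p (e x p) (e y p) (e z p) =
      D (e x) (D (e y) (e z)) p - D (e y) (D (e x) (e z)) p - D (lie_bracket A (e x) (e y)) (e z) p"
    using R V e c(2) unfolding is_curvature_tensor_def by blast
  ultimately show ?thesis using coord_field_at[OF p] by (simp add: e_def)
qed

end

context levi_civita_connection
begin

text \<open>All identities are checked on coordinate fields \<open>X, Y, Z\<close> near \<open>p\<close>, where
  \<open>R(X,Y)Z = D\<^sub>X D\<^sub>Y Z - D\<^sub>Y D\<^sub>X Z\<close>. Since brackets vanish, torsion-freeness says \<open>D\<^sub>Y Z = D\<^sub>Z Y\<close> near \<open>p\<close>,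
  and the six terms of the Bianchi identity cancel in pairs. For skewness it suffices that
  \<open>g(R(X,Y)Z, Z) = 0\<close>: metric compatibility gives
  \<open>X(Y g(Z,Z)) = 2 g(D\<^sub>X D\<^sub>Y Z, Z) + 2 g(D\<^sub>Y Z, D\<^sub>X Z)\<close>, and the left side is symmetric in \<open>X\<close>
  and \<open>Y\<close>.\<close>

lemma algebraic_curvature_at_point:
  assumes R: "is_curvature_tensor A D R" and p: "p \<in> carrier A"
  shows "algebraic_curvature (g p) (R p)"
proof -
  define c where "c = chart_at A p"
  have c: "c \<in> A" "p \<in> region c" using chart_at[OF p] by (auto simp: c_def)
  define e where "e = coord_field A c"
  note V = open_in_region[OF c(1)]
  have e: "smooth_field A (region c) (e v)" for v
    unfolding e_def by (rule smooth_coord_field[OF c(1)])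
  have De: "smooth_field A (region c) (D (e v) (e w))" for v w
    by (intro smooth[OF V] e)
  have e_lin: "linear (\<lambda>v. e v q)" if "q \<in> region c" for q
    unfolding e_def using coord_field_linear[OF c(1) that] .
  have e_p: "e v p = v" for v unfolding e_def c_def using coord_field_at[OF p] .
  have R_eq: "R p x y z = D (e x) (D (e y) (e z)) p - D (e y) (D (e x) (e z)) p" for x y z
    unfolding e_def c_def by (rule curvature_coord_field[OF R p])
  have sym: "D (e x) (e y) q = D (e y) (e x) q" if "q \<in> region c" for x y q
    using torsion_free[OF V e e that] lie_bracket_coord_field[OF c(1) that] by (simp add: e_def)
  have e_add: "e (v + w) q = e v q + e w q" if "q \<in> region c" for v w q
    using linear_add[OF e_lin[OF that]] .
  have e_scale: "e (r *\<^sub>R v) q = r *\<^sub>R e v q" if "q \<in> region c" for v r q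
    using linear_scale[OF e_lin[OF that]] .
  have add_r: "D (e x) (e (y + y')) q = D (e x) (e y) q + D (e x) (e y') q" if "q \<in> region c" for x y y' q
    by (rule D_add_right[OF V e e e e e_add that])
  have scale_r: "D (e x) (e (r *\<^sub>R y)) q = r *\<^sub>R D (e x) (e y) q" if "q \<in> region c" for x y r q
    by (rule D_scale_right[OF V e e e e_scale that])
  have DD_add_r: "D (e x) (D (e y) (e (z + z'))) p = D (e x) (D (e y) (e z)) p + D (e x) (D (e y) (e z')) p"
    for x y z z'
    by (rule D_add_right[OF V e De De De add_r c(2)])
  have DD_scale_r: "D (e x) (D (e y) (e (r *\<^sub>R z))) p = r *\<^sub>R D (e x) (D (e y) (e z)) p" for x y z r
    by (rule D_scale_right[OF V e De De scale_r c(2)])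
  have DD_sym: "D (e x) (D (e y) (e z)) p = D (e x) (D (e z) (e y)) p" for x y z
    by (rule local[OF V e De e De refl sym c(2)])
  have DD_add_l: "D (e (x + x')) (D (e y) (e z)) p = D (e x) (D (e y) (e z)) p + D (e x') (D (e y) (e z)) p"
    for x x' y z
    by (rule D_add_left[OF V De e e e e_add c(2)])
  have DD_scale_l: "D (e (r *\<^sub>R x)) (D (e y) (e z)) p = r *\<^sub>R D (e x) (D (e y) (e z)) p" for x y z r
    by (rule D_scale_left[OF V De e e e_scale c(2)])
  have lin3: "linear (\<lambda>z. R p x y z)" for x y
    by (rule linearI) (simp_all add: R_eq DD_add_r DD_scale_r algebra_simps)
  have lin2: "linear (\<lambda>y. R p x y z)" for x z
    by (rule linearI) (simp_all add: R_eq DD_sym[of _ _ z] DD_add_r DD_scale_r DD_add_l DD_scale_l algebra_simps)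
  note g_lin = metric_bilinear[OF p, unfolded bilinear_def]
  have R_null: "g p (R p x y z) z = 0" for x y z
  proof -
    let ?f = "\<lambda>q. g q (e z q) (e z q)"
    have f: "smooth_fun A (region c) ?f" by (rule metric_smooth[OF V e e])
    have second: "dir_deriv A p x (\<lambda>q. dir_deriv A q (e y q) ?f)
        = 2 * g p (D (e x) (D (e y) (e z)) p) z + 2 * g p (D (e y) (e z) p) (D (e x) (e z) p)" for x y
    proof -
      \<comment> \<open>The factor 2 is absorbed into the field \<open>2 Z\<close>, so that metric compatibility can be applied a second time as it stands.\<close>
      have "dir_deriv A q (e y q) ?f = g q (D (e y) (e (2 *\<^sub>R z)) q) (e z q)" if q: "q \<in> region c" for q
      proof -
        have qc: "q \<in> carrier A" using region_carrier[OF c(1) q] .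
        have "linear (\<lambda>v. g q v (e z q))" using metric_bilinear[OF qc] by (simp add: bilinear_def)
        from linear_scale[OF this] show ?thesis
          using metric_compatible[OF V e e e q, of y z z] scale_r[OF q, of y 2 z]
            metric_sym[OF qc, of "e z q" "D (e y) (e z) q"] by simp
      qed
      then have "dir_deriv A p x (\<lambda>q. dir_deriv A q (e y q) ?f)
          = dir_deriv A p (e x p) (\<lambda>q. g q (D (e y) (e (2 *\<^sub>R z)) q) (e z q))"
        unfolding e_p by (intro dir_deriv_cong[OF p V c(2) metric_smooth[OF V De e], symmetric]) simp
      also have "\<dots> = g p (D (e x) (D (e y) (e (2 *\<^sub>R z))) p) z + g p (D (e y) (e (2 *\<^sub>R z)) p) (D (e x) (e z) p)"
        using metric_compatible[OF V e De e c(2), of x y "2 *\<^sub>R z" z] by (simp add: e_p)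
      also have "\<dots> = 2 * g p (D (e x) (D (e y) (e z)) p) z + 2 * g p (D (e y) (e z) p) (D (e x) (e z) p)"
        using g_lin by (simp add: DD_scale_r scale_r[OF c(2)] linear_scale[of "\<lambda>v. g p v _"])
      finally show ?thesis .
    qed
    have "dir_deriv A p x (\<lambda>q. dir_deriv A q (e y q) ?f) = dir_deriv A p y (\<lambda>q. dir_deriv A q (e x q) ?f)"
      unfolding e_def using f by (intro dir_deriv_commute[OF p c_def]) (simp add: e_def)
    then have "g p (D (e x) (D (e y) (e z)) p) z = g p (D (e y) (D (e x) (e z)) p) z"
      using metric_sym[OF p] by (simp add: second)
    then show ?thesis
      using g_lin by (simp add: R_eq linear_diff[of "\<lambda>v. g p v _"])
  qed
  show ?thesis
  proof (intro algebraic_curvature.intro scalar_product.intro algebraic_curvature_axioms.intro)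
    show "bilinear (g p)" by (rule metric_bilinear[OF p])
    show "g p x y = g p y x" for x y by (rule metric_sym[OF p])
    fix x assume "\<And>y. g p x y = 0"
    then show "x = 0" by (rule metric_nondegenerate[OF p])
  next
    show "linear (\<lambda>y. R p x y z)" for x z by (rule lin2)
    show "linear (\<lambda>z. R p x y z)" for x y by (rule lin3)
    show "R p x y z = - R p y x z" for x y z by (simp add: R_eq)
    show "g p (R p x y z) w = - g p z (R p x y w)" for x y z w
    proof -
      \<comment> \<open>Polarization of \<open>g(R(x,y)z, z) = 0\<close>.\<close>
      have "g p (R p x y (z + w)) (z + w) = 0" by (rule R_null)
      moreover have "linear (g p v)" "linear (\<lambda>u. g p u v)" for v using g_lin by auto
      ultimately have "g p (R p x y z) w + g p (R p x y w) z = 0"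
        by (simp add: linear_add[OF lin3] linear_add[of "g p _"] linear_add[of "\<lambda>u. g p u _"] R_null)
      then show ?thesis using metric_sym[OF p] by simp
    qed
    show "R p x y z + R p y z x + R p z x y = 0" for x y z
      by (simp add: R_eq DD_sym[of x z y] DD_sym[of y x z] DD_sym[of z y x])
  qed
qed

end

section \<open>Pseudosymmetric manifolds\<close>

theorem theorem6p4:
  fixes A :: "('a::{t2_space, second_countable_topology}, 'n::finite) chart set"
    and g :: "'a \<Rightarrow> real ^ 'n \<Rightarrow> real ^ 'n \<Rightarrow> real"
    and D :: "('a \<Rightarrow> real ^ 'n) \<Rightarrow> ('a \<Rightarrow> real ^ 'n) \<Rightarrow> 'a \<Rightarrow> real ^ 'n"
    and R :: "'a \<Rightarrow> real ^ 'n \<Rightarrow> real ^ 'n \<Rightarrow> real ^ 'n \<Rightarrow> real ^ 'n"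
    and \<epsilon> k :: real
    and \<xi> Y U :: "'a \<Rightarrow> real ^ 'n"
    and a :: "nat \<Rightarrow> real"
    and L :: "'a \<Rightarrow> real"
    and p :: 'a
  assumes "Nk_semi_riemannian_manifold A g D R \<epsilon> k \<xi>"
    and "pseudosymmetric A g R a L"
    and "smooth_field A (carrier A) Y" and "smooth_field A (carrier A) U"
    and "p \<in> carrier A"
  shows "let n = real CARD('n);
             S = ricci (R p); r = scalar_curv (g p) (R p);
             \<eta> = (\<lambda>x. \<epsilon> * g p x (\<xi> p));
             E = \<epsilon> * (k * a 0 + a 7 * r - k * (n - 1) * a 1 - k * (n - 1) * a 2);
             F = - \<epsilon> * k * (n - 1) * (k * a 0 + k * (n - 1) * a 4 + a 7 * r);
             G = - k\<^sup>2 * (n - 1)\<^sup>2 * (a 1 + a 2 + 2 * a 3 + a 4 + a 5 + 2 * a 6)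
         in \<epsilon> * a 5 * ricci_sq (g p) (R p) (Y p) (U p) - E * S (Y p) (U p)
              - F * g p (Y p) (U p) - G * \<eta> (Y p) * \<eta> (U p)
            = L p * (\<epsilon> * k * (n - 1) * g p (Y p) (U p) - \<epsilon> * S (Y p) (U p))"
proof -
  interpret Nk_semi_riemannian_manifold A g D R \<epsilon> k \<xi> by (rule assms(1))
  interpret algebraic_curvature "g p" "R p"
    by (rule algebraic_curvature_at_point[OF curvature assms(5)])
  have psym: "act (T_tensor a (g p) (R p) (\<xi> p) (Y p)) (ricci (R p)) (\<xi> p) (U p)
      = L p * act (wedge (g p) (\<xi> p) (Y p)) (ricci (R p)) (\<xi> p) (U p)"
    using assms(2,5) by (simp add: pseudosymmetric_def)
  have \<epsilon>: "\<epsilon> * \<epsilon> = 1" using eps by auto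
  then have \<eta>\<eta>: "s * (\<epsilon> * v) * (\<epsilon> * w) = s * v * w" for s v w
    by (metis mult.assoc mult.left_commute mult_1)
  show ?thesis
    using pseudosymmetric_at_point[OF xi_nullity[OF assms(5)] xi_unit[OF assms(5)] psym]
    unfolding Let_def \<eta>\<eta> by simp
qed

end
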